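(* Let $T$ be a theory over a finite relational language. The class of (countable) infinite models of $T$ has the $0$-Ramsey property, and therefore each such model has a generically computable copy. Furthermore, every such model has a coarsely computable copy.
   Context: Structures are countable with universe $\omega$ (substructures have universe a subset of $\omega$); a copy of a structure is a structure with universe $\omega$ isomorphic to it. A class $\mathbb{K}$ of structures has the $0$-Ramsey property if every $\mathcal{M}\in\mathbb{K}$ has an infinite substructure that has a computable copy (a copy all of whose relations are computable). A set $D\subseteq\omega$ is dense if $\lim_{n\to\infty}|D\cap\{0,\dots,n\}|/(n+1)=1$. A relational structure $\mathcal{A}$ is generically computable if there is a dense c.e. set $D$ such that for each $k$-ary relation $R$ of $\mathcal{A}$, the restriction $\chi_R\restriction D^k$ is the restriction to $D^k$ of a partial computable function. A relational structure $\mathcal{A}$ is coarsely computable if there are a dense set $D\subseteq\omega$ and a computable structure $\mathcal{E}$ (with universe $\omega$) such that a structure $\mathcal{D}$ with universe $D$ is a substructure of both $\mathcal{A}$ and $\mathcal{E}$. *)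

theory Defs
  imports Complex_Main
begin

text \<open>Partial recursive functions. A program has no fixed arity; for each \<open>k\<close> it computes a
  partial function on lists of length \<open>k\<close>. Where the arities of its parts do not match, it is
  undefined.\<close>

datatype recf =
    Zero
  | Succ
  | Proj nat
  | Comp recf "recf list"
  | PrimRec recf recf
  | Mu recf

inductive reval :: "recf \<Rightarrow> nat list \<Rightarrow> nat \<Rightarrow> bool" where
  reval_Zero: "reval Zero xs 0"
| reval_Succ: "reval Succ [x] (Suc x)"
| reval_Proj: "i < length xs \<Longrightarrow> reval (Proj i) xs (xs ! i)"
| reval_Comp: "list_all2 (\<lambda>g y. reval g xs y) gs ys \<Longrightarrow> reval f ys z \<Longrightarrow> reval (Comp f gs) xs z"
| reval_PrimRec_0: "reval f xs y \<Longrightarrow> reval (PrimRec f g) (0 # xs) y"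
| reval_PrimRec_Suc: "reval (PrimRec f g) (n # xs) y \<Longrightarrow> reval g (n # y # xs) z \<Longrightarrow>
    reval (PrimRec f g) (Suc n # xs) z"
| reval_Mu: "reval f (n # xs) 0 \<Longrightarrow> (\<forall>m<n. \<exists>y. reval f (m # xs) (Suc y)) \<Longrightarrow> reval (Mu f) xs n"

lemma reval_deterministic:
  assumes "reval p xs y" and "reval p xs z"
  shows "y = z"
  using assms
proof (induction arbitrary: z rule: reval.induct)
  case (reval_Zero xs)
  then show ?case by (cases rule: reval.cases) auto
next
  case (reval_Succ x)
  then show ?case by (cases rule: reval.cases) auto
next
  case (reval_Proj i xs)
  from reval_Proj(2) show ?case by (cases rule: reval.cases) auto
next
  case (reval_Comp xs gs ys f z z')
  from reval_Comp.prems obtain ys' where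
    ys': "list_all2 (\<lambda>g y. reval g xs y) gs ys'" "reval f ys' z'"
    by (cases rule: reval.cases) auto
  have "ys = ys'"
    using reval_Comp.IH(1) ys'(1) by (auto simp: list_all2_conv_all_nth intro!: nth_equalityI)
  then show ?case using reval_Comp.IH(2) ys'(2) by blast
next
  case (reval_PrimRec_0 f xs y g)
  from reval_PrimRec_0.prems show ?case
    by (cases rule: reval.cases) (auto dest: reval_PrimRec_0.IH)
next
  case (reval_PrimRec_Suc f g n xs y z)
  from reval_PrimRec_Suc.prems show ?case
    by (cases rule: reval.cases)
      (auto dest!: reval_PrimRec_Suc.IH(1) dest: reval_PrimRec_Suc.IH(2))
next
  case (reval_Mu f n xs)
  from reval_Mu.prems have z: "reval f (z # xs) 0" "\<forall>m<z. \<exists>y. reval f (m # xs) (Suc y)"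
    by (cases rule: reval.cases; blast)+
  show ?case
  proof (rule linorder_cases[of n z])
    assume "n < z"
    with z(2) reval_Mu.IH(1) show ?thesis by blast
  next
    assume "z < n"
    with reval_Mu.IH(2) z(1) show ?thesis by blast
  qed
qed

definition partial_computable :: "nat \<Rightarrow> (nat list \<rightharpoonup> nat) \<Rightarrow> bool" where
  "partial_computable k \<phi> \<longleftrightarrow>
     (\<exists>p. \<forall>xs y. length xs = k \<longrightarrow> (\<phi> xs = Some y \<longleftrightarrow> reval p xs y))"

definition ce_set :: "nat set \<Rightarrow> bool" where
  "ce_set D \<longleftrightarrow> (\<exists>\<phi>. partial_computable 1 \<phi> \<and> D = {x. [x] \<in> dom \<phi>})"

definition char_fun :: "nat list set \<Rightarrow> nat list \<Rightarrow> nat" where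
  "char_fun R xs = (if xs \<in> R then 1 else 0)"

definition computable_relation :: "nat \<Rightarrow> nat list set \<Rightarrow> bool" where
  "computable_relation k R \<longleftrightarrow> partial_computable k (\<lambda>xs. Some (char_fun R xs))"

definition dense_set :: "nat set \<Rightarrow> bool" where
  "dense_set D \<longleftrightarrow> (\<lambda>n. real (card (D \<inter> {0..n})) / (real n + 1)) \<longlonglongrightarrow> 1"

text \<open>Relational languages and first-order logic with equality.\<close>

record 'r language =
  symbols :: "'r set"
  arity :: "'r \<Rightarrow> nat"

record 'r rstruct =
  univ :: "nat set"
  interp :: "'r \<Rightarrow> nat list set"

definition tuples :: "nat \<Rightarrow> nat set \<Rightarrow> nat list set" where
  "tuples k A = {xs. length xs = k \<and> set xs \<subseteq> A}"

text \<open>Interpretations of symbols outside the language are ignored throughout.\<close>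

definition is_structure :: "'r language \<Rightarrow> 'r rstruct \<Rightarrow> bool" where
  "is_structure L M \<longleftrightarrow>
     univ M \<noteq> {} \<and> (\<forall>R\<in>symbols L. interp M R \<subseteq> tuples (arity L R) (univ M))"

datatype 'r fm =
    Eq nat nat
  | Rel 'r "nat list"
  | Neg "'r fm"
  | Conj "'r fm" "'r fm"
  | All nat "'r fm"

primrec free_vars :: "'r fm \<Rightarrow> nat set" where
  "free_vars (Eq i j) = {i, j}"
| "free_vars (Rel R is) = set is"
| "free_vars (Neg \<phi>) = free_vars \<phi>"
| "free_vars (Conj \<phi> \<psi>) = free_vars \<phi> \<union> free_vars \<psi>"
| "free_vars (All i \<phi>) = free_vars \<phi> - {i}"

primrec is_formula :: "'r language \<Rightarrow> 'r fm \<Rightarrow> bool" where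
  "is_formula L (Eq i j) \<longleftrightarrow> True"
| "is_formula L (Rel R is) \<longleftrightarrow> R \<in> symbols L \<and> length is = arity L R"
| "is_formula L (Neg \<phi>) \<longleftrightarrow> is_formula L \<phi>"
| "is_formula L (Conj \<phi> \<psi>) \<longleftrightarrow> is_formula L \<phi> \<and> is_formula L \<psi>"
| "is_formula L (All i \<phi>) \<longleftrightarrow> is_formula L \<phi>"

primrec sat :: "'r rstruct \<Rightarrow> (nat \<Rightarrow> nat) \<Rightarrow> 'r fm \<Rightarrow> bool" where
  "sat M e (Eq i j) \<longleftrightarrow> e i = e j"
| "sat M e (Rel R is) \<longleftrightarrow> map e is \<in> interp M R"
| "sat M e (Neg \<phi>) \<longleftrightarrow> \<not> sat M e \<phi>"
| "sat M e (Conj \<phi> \<psi>) \<longleftrightarrow> sat M e \<phi> \<and> sat M e \<psi>"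
| "sat M e (All i \<phi>) \<longleftrightarrow> (\<forall>a\<in>univ M. sat M (e(i := a)) \<phi>)"

definition is_theory :: "'r language \<Rightarrow> 'r fm set \<Rightarrow> bool" where
  "is_theory L T \<longleftrightarrow> (\<forall>\<phi>\<in>T. is_formula L \<phi> \<and> free_vars \<phi> = {})"

definition is_model :: "'r language \<Rightarrow> 'r fm set \<Rightarrow> 'r rstruct \<Rightarrow> bool" where
  "is_model L T M \<longleftrightarrow> is_structure L M \<and> (\<forall>\<phi>\<in>T. \<forall>e. range e \<subseteq> univ M \<longrightarrow> sat M e \<phi>)"

text \<open>Countably infinite models are taken with universe \<open>\<omega>\<close>.\<close>

definition infinite_models :: "'r language \<Rightarrow> 'r fm set \<Rightarrow> 'r rstruct set" where
  "infinite_models L T = {M. univ M = UNIV \<and> is_model L T M}"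

definition isomorphic :: "'r language \<Rightarrow> 'r rstruct \<Rightarrow> 'r rstruct \<Rightarrow> bool" where
  "isomorphic L M N \<longleftrightarrow>
     (\<exists>f. bij_betw f (univ M) (univ N) \<and>
          (\<forall>R\<in>symbols L. \<forall>xs\<in>tuples (arity L R) (univ M).
             xs \<in> interp M R \<longleftrightarrow> map f xs \<in> interp N R))"

definition is_copy :: "'r language \<Rightarrow> 'r rstruct \<Rightarrow> 'r rstruct \<Rightarrow> bool" where
  "is_copy L M N \<longleftrightarrow> is_structure L N \<and> univ N = UNIV \<and> isomorphic L M N"

definition substructure :: "'r language \<Rightarrow> 'r rstruct \<Rightarrow> 'r rstruct \<Rightarrow> bool" where
  "substructure L N M \<longleftrightarrow>
     is_structure L N \<and> is_structure L M \<and> univ N \<subseteq> univ M \<and>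
     (\<forall>R\<in>symbols L. interp N R = interp M R \<inter> tuples (arity L R) (univ N))"

definition computable_structure :: "'r language \<Rightarrow> 'r rstruct \<Rightarrow> bool" where
  "computable_structure L E \<longleftrightarrow>
     is_structure L E \<and> univ E = UNIV \<and>
     (\<forall>R\<in>symbols L. computable_relation (arity L R) (interp E R))"

definition zero_Ramsey_property :: "'r language \<Rightarrow> 'r rstruct set \<Rightarrow> bool" where
  "zero_Ramsey_property L K \<longleftrightarrow>
     (\<forall>M\<in>K. \<exists>N. substructure L N M \<and> infinite (univ N) \<and>
        (\<exists>C. is_copy L N C \<and> computable_structure L C))"

definition generically_computable :: "'r language \<Rightarrow> 'r rstruct \<Rightarrow> bool" where
  "generically_computable L A \<longleftrightarrow>
     (\<exists>D. dense_set D \<and> ce_set D \<and>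
        (\<forall>R\<in>symbols L. \<exists>\<phi>. partial_computable (arity L R) \<phi> \<and>
           (\<forall>xs\<in>tuples (arity L R) D. \<phi> xs = Some (char_fun (interp A R) xs))))"

definition coarsely_computable :: "'r language \<Rightarrow> 'r rstruct \<Rightarrow> bool" where
  "coarsely_computable L A \<longleftrightarrow>
     (\<exists>D E. dense_set (univ D) \<and> computable_structure L E \<and>
        substructure L D A \<and> substructure L D E)"

end

theory Submission
  imports Defs "HOL-Library.Ramsey" "HOL-Library.Infinite_Set" "HOL-Library.Discrete_Functions"
    "HOL-Real_Asymp.Real_Asymp"
begin

text \<open>
  The engine is Ramsey's theorem. Fix an infinite model. For each relation symbol \<open>R\<close> and each way of
  ordering the entries of a tuple, colour a finite set of elements by whether \<open>R\<close> holds of the tuple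
  that enumerates the set in that way. As the language is finite, there are finitely many such
  two-colourings, and they have a common homogeneous infinite set \<open>Y\<close> (\<open>ex_order_homogeneous\<close>): for
  tuples from \<open>Y\<close>, the truth of \<open>R xs\<close> depends only on the order type of \<open>xs\<close>, that is, on which
  entries are smaller than which.

  For each \<open>R\<close> let \<open>P R\<close> be the finite set of order types that make \<open>R\<close> true on \<open>Y\<close>. The structure on
  \<open>\<omega>\<close> in which \<open>R\<close> holds of exactly the tuples with order type in \<open>P R\<close> is computable
  (\<open>computable_relation_order_type\<close>), and the increasing enumeration of \<open>Y\<close> embeds it in the model
  with image \<open>Y\<close>. This is the \<open>0\<close>-Ramsey property.

  For the two statements on copies, let \<open>D\<close> be the set of non-squares, a dense c.e. set with infinite
  complement. Pull the model back along a permutation of \<open>\<omega>\<close> that is increasing on \<open>D\<close> and maps \<open>D\<close>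
  into \<open>Y\<close> (\<open>ex_bij_increasing_on\<close>). An increasing map preserves order types, so on \<open>D\<close> the resulting
  copy agrees with the computable structure above. Hence it is coarsely computable, and, as \<open>D\<close> is
  c.e., generically computable.
\<close>

section \<open>Computable functions and relations\<close>

definition computable_fun :: "nat \<Rightarrow> (nat list \<Rightarrow> nat) \<Rightarrow> bool" where
  "computable_fun k f \<longleftrightarrow> (\<exists>p. \<forall>xs. length xs = k \<longrightarrow> reval p xs (f xs))"

lemma computable_relation_iff: "computable_relation k R \<longleftrightarrow> computable_fun k (char_fun R)"
  unfolding computable_relation_def partial_computable_def computable_fun_def
  by (metis option.inject reval_deterministic)

lemma computable_fun_cong:
  "(\<And>xs. length xs = k \<Longrightarrow> f xs = g xs) \<Longrightarrow> computable_fun k f \<longleftrightarrow> computable_fun k g"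
  by (auto simp: computable_fun_def)

lemma computable_fun_nth: "i < k \<Longrightarrow> computable_fun k (\<lambda>xs. xs ! i)"
  unfolding computable_fun_def using reval_Proj by blast

lemma computable_fun_zero: "computable_fun k (\<lambda>xs. 0)"
  unfolding computable_fun_def using reval_Zero by blast

lemma computable_fun_Suc:
  assumes "computable_fun k f"
  shows "computable_fun k (\<lambda>xs. Suc (f xs))"
proof -
  obtain p where "\<And>xs. length xs = k \<Longrightarrow> reval p xs (f xs)"
    using assms by (auto simp: computable_fun_def)
  then have "reval (Comp Succ [p]) xs (Suc (f xs))" if "length xs = k" for xs
    using that by (intro reval_Comp[where ys = "[f xs]"] reval_Succ) auto
  then show ?thesis unfolding computable_fun_def by blast
qed

lemma computable_fun_comp2:
  assumes "computable_fun 2 (\<lambda>xs. h (xs ! 0) (xs ! 1))"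
    and "computable_fun k f" and "computable_fun k g"
  shows "computable_fun k (\<lambda>xs. h (f xs) (g xs))"
proof -
  obtain q where q: "\<And>xs. length xs = 2 \<Longrightarrow> reval q xs (h (xs ! 0) (xs ! 1))"
    using assms(1) by (auto simp: computable_fun_def)
  obtain p1 p2 where "\<And>xs. length xs = k \<Longrightarrow> reval p1 xs (f xs)"
    and "\<And>xs. length xs = k \<Longrightarrow> reval p2 xs (g xs)"
    using assms(2,3) by (auto simp: computable_fun_def)
  moreover have "reval q [f xs, g xs] (h (f xs) (g xs))" for xs
    using q[of "[f xs, g xs]"] by simp
  ultimately have "reval (Comp q [p1, p2]) xs (h (f xs) (g xs))" if "length xs = k" for xs
    using that by (intro reval_Comp[where ys = "[f xs, g xs]"]) auto
  then show ?thesis unfolding computable_fun_def by blast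
qed

lemma computable_fun_primrec2:
  assumes f: "computable_fun 1 (\<lambda>xs. h 0 (xs ! 0))"
    and g: "computable_fun 3 g"
    and step: "\<And>n y. g [n, h n y, y] = h (Suc n) y"
  shows "computable_fun 2 (\<lambda>xs. h (xs ! 0) (xs ! 1))"
proof -
  obtain p where p: "\<And>xs. length xs = 1 \<Longrightarrow> reval p xs (h 0 (xs ! 0))"
    using f by (auto simp: computable_fun_def)
  obtain q where q: "\<And>xs. length xs = 3 \<Longrightarrow> reval q xs (g xs)"
    using g by (auto simp: computable_fun_def)
  have "reval (PrimRec p q) [n, y] (h n y)" for n y
  proof (induction n)
    case 0
    show ?case using p[of "[y]"] by (intro reval_PrimRec_0) simp
  next
    case (Suc n)
    then show ?case using q[of "[n, h n y, y]"] by (auto intro!: reval_PrimRec_Suc simp: step)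
  qed
  then have "reval (PrimRec p q) xs (h (xs ! 0) (xs ! 1))" if "length xs = 2" for xs
    using that by (auto simp: length_Suc_conv numeral_2_eq_2)
  then show ?thesis unfolding computable_fun_def by blast
qed

lemma computable_fun_add:
  assumes "computable_fun k f" and "computable_fun k g"
  shows "computable_fun k (\<lambda>xs. f xs + g xs)"
proof (rule computable_fun_comp2[OF _ assms])
  show "computable_fun 2 (\<lambda>xs. xs ! 0 + xs ! 1)"
    by (rule computable_fun_primrec2[where g = "\<lambda>xs. Suc (xs ! 1)"])
      (auto intro!: computable_fun_Suc computable_fun_nth)
qed

lemma computable_fun_mult:
  assumes "computable_fun k f" and "computable_fun k g"
  shows "computable_fun k (\<lambda>xs. f xs * g xs)"
proof (rule computable_fun_comp2[OF _ assms])
  show "computable_fun 2 (\<lambda>xs. xs ! 0 * xs ! 1)"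
    by (rule computable_fun_primrec2[where g = "\<lambda>xs. xs ! 1 + xs ! 2"])
      (auto intro!: computable_fun_add computable_fun_zero computable_fun_nth)
qed

lemma computable_fun_diff:
  assumes "computable_fun k f" and "computable_fun k g"
  shows "computable_fun k (\<lambda>xs. f xs - g xs)"
proof -
  \<comment> \<open>Recursion is on the first argument, so the predecessor carries a dummy second argument,
    and subtraction is computed with its arguments exchanged.\<close>
  have "computable_fun 2 (\<lambda>xs. (\<lambda>n y. n - 1) (xs ! 0) (xs ! 1))"
    by (rule computable_fun_primrec2[where g = "\<lambda>xs. xs ! 0"])
      (auto intro!: computable_fun_zero computable_fun_nth)
  then have pred: "computable_fun k (\<lambda>xs. f xs - 1)" if "computable_fun k f" for k f
    using computable_fun_comp2[OF _ that that] by fastforce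
  have "computable_fun 2 (\<lambda>xs. (\<lambda>n y. y - n) (xs ! 0) (xs ! 1))"
    by (rule computable_fun_primrec2[where g = "\<lambda>xs. xs ! 1 - 1"])
      (auto intro!: pred[unfolded One_nat_def] computable_fun_nth)
  from computable_fun_comp2[OF this assms(2,1)] show ?thesis .
qed

lemma computable_relation_cong:
  "(\<And>xs. length xs = k \<Longrightarrow> xs \<in> R \<longleftrightarrow> xs \<in> S) \<Longrightarrow>
    computable_relation k R \<longleftrightarrow> computable_relation k S"
  unfolding computable_relation_iff by (rule computable_fun_cong) (simp add: char_fun_def)

text \<open>On the values \<open>0\<close> and \<open>1\<close>, subtraction from \<open>1\<close> is negation and multiplication is conjunction.\<close>

lemma computable_relation_Compl:
  assumes "computable_relation k R"
  shows "computable_relation k (- R)"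
proof -
  have "char_fun (- R) = (\<lambda>xs. Suc 0 - char_fun R xs)"
    by (auto simp: char_fun_def)
  then show ?thesis
    using assms by (auto simp: computable_relation_iff
        intro!: computable_fun_diff computable_fun_Suc computable_fun_zero)
qed

lemma computable_relation_Int:
  assumes "computable_relation k R" and "computable_relation k S"
  shows "computable_relation k (R \<inter> S)"
proof -
  have "char_fun (R \<inter> S) = (\<lambda>xs. char_fun R xs * char_fun S xs)"
    by (auto simp: char_fun_def)
  then show ?thesis
    using assms by (auto simp: computable_relation_iff intro: computable_fun_mult)
qed

lemma computable_relation_UNIV: "computable_relation k UNIV"
proof -
  have "char_fun UNIV = (\<lambda>xs. Suc 0)"
    by (auto simp: char_fun_def)
  then show ?thesis
    by (auto simp: computable_relation_iff intro: computable_fun_Suc computable_fun_zero)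
qed

lemma computable_relation_INT:
  assumes "finite I" and "\<And>i. i \<in> I \<Longrightarrow> computable_relation k (R i)"
  shows "computable_relation k (\<Inter>i\<in>I. R i)"
  using assms
  by (induction I rule: finite_induct) (auto intro: computable_relation_UNIV computable_relation_Int)

lemma computable_relation_UN:
  assumes "finite I" and "\<And>i. i \<in> I \<Longrightarrow> computable_relation k (R i)"
  shows "computable_relation k (\<Union>i\<in>I. R i)"
proof -
  have "(\<Union>i\<in>I. R i) = - (\<Inter>i\<in>I. - R i)"
    by auto
  then show ?thesis
    using assms by (simp only:) (intro computable_relation_Compl computable_relation_INT)
qed

lemma computable_relation_less:
  assumes "computable_fun k f" and "computable_fun k g"
  shows "computable_relation k {xs. f xs < g xs}"
proof -
  have "char_fun {xs. f xs < g xs} = (\<lambda>xs. Suc 0 - (Suc 0 - (g xs - f xs)))"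
    by (auto simp: char_fun_def)
  then show ?thesis
    using assms by (auto simp: computable_relation_iff
        intro!: computable_fun_diff computable_fun_Suc computable_fun_zero)
qed

text \<open>A witness \<open>n\<close> for \<open>x\<close> is found by unbounded search, which terminates exactly when there is one.\<close>

lemma ce_set_projection:
  assumes "computable_relation 2 S"
  shows "ce_set {x. \<exists>n. [n, x] \<in> S}"
proof -
  have "computable_fun 2 (char_fun (- S))"
    using computable_relation_Compl[OF assms] by (simp add: computable_relation_iff)
  then obtain p where p: "\<And>xs. length xs = 2 \<Longrightarrow> reval p xs (char_fun (- S) xs)"
    by (auto simp: computable_fun_def)
  have p_eq: "reval p [n, x] y \<longleftrightarrow> y = char_fun (- S) [n, x]" for n x y
    using p[of "[n, x]"] reval_deterministic by auto
  have halts: "(\<exists>y. reval (Mu p) [x] y) \<longleftrightarrow> (\<exists>n. [n, x] \<in> S)" for x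
  proof
    assume "\<exists>y. reval (Mu p) [x] y"
    then obtain y where "reval (Mu p) [x] y" ..
    then have "reval p [y, x] 0"
      by (cases rule: reval.cases) auto
    then have "[y, x] \<in> S"
      by (auto simp: p_eq char_fun_def split: if_splits)
    then show "\<exists>n. [n, x] \<in> S" ..
  next
    assume *: "\<exists>n. [n, x] \<in> S"
    define n where "n = (LEAST n. [n, x] \<in> S)"
    have "[n, x] \<in> S"
      unfolding n_def using * by (rule LeastI_ex)
    moreover have "[m, x] \<notin> S" if "m < n" for m
      using that unfolding n_def by (rule not_less_Least)
    ultimately have "reval (Mu p) [x] n"
      by (intro reval_Mu) (auto simp: p_eq char_fun_def)
    then show "\<exists>y. reval (Mu p) [x] y" ..
  qed
  define \<phi> where
    "\<phi> xs = (if \<exists>y. reval (Mu p) xs y then Some (THE y. reval (Mu p) xs y) else None)" for xs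
  have "\<phi> xs = Some y \<longleftrightarrow> reval (Mu p) xs y" for xs y
    unfolding \<phi>_def using reval_deterministic[of "Mu p" xs] by (auto intro: theI2 simp: the_equality)
  then have "partial_computable 1 \<phi>"
    unfolding partial_computable_def by blast
  moreover have "{x. \<exists>n. [n, x] \<in> S} = {x. [x] \<in> dom \<phi>}"
    by (auto simp: halts[symmetric] \<phi>_def split: if_splits)
  ultimately show ?thesis
    unfolding ce_set_def by blast
qed

section \<open>The set of non-squares\<close>

definition nonsquares :: "nat set" where
  "nonsquares = - range (\<lambda>m. m * m)"

text \<open>This form exhibits the non-squares as the projection of a computable relation.\<close>

lemma nonsquares_eq: "nonsquares = {x. \<exists>n. n * n < x \<and> x < Suc n * Suc n}"
proof -
  have "n * n < x \<and> x < Suc n * Suc n \<Longrightarrow> x \<noteq> m * m" for n m x :: nat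
    by (cases "m \<le> n") (use mult_le_mono[of m n m n] mult_le_mono[of "Suc n" m "Suc n" m] in auto)
  moreover have "\<exists>n. n * n < x \<and> x < Suc n * Suc n" if "\<And>m. x \<noteq> m * m" for x :: nat
    using floor_sqrt_power2_le[of x] Suc_floor_sqrt_power2_gt[of x] that[of "floor_sqrt x"]
    by (intro exI[of _ "floor_sqrt x"]) (auto simp: power2_eq_square)
  ultimately show ?thesis
    unfolding nonsquares_def by blast
qed

lemma ce_set_nonsquares: "ce_set nonsquares"
proof -
  have "computable_relation 2
      ({xs. xs ! 0 * xs ! 0 < xs ! 1} \<inter> {xs. xs ! 1 < Suc (xs ! 0) * Suc (xs ! 0)})"
    by (intro computable_relation_Int computable_relation_less computable_fun_mult
        computable_fun_Suc computable_fun_nth) auto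
  from ce_set_projection[OF this] show ?thesis
    by (simp add: nonsquares_eq)
qed

lemma infinite_Compl_nonsquares: "infinite (- nonsquares)"
proof -
  have "inj (\<lambda>m::nat. m * m)"
    by (auto intro!: injI simp: power2_eq_square[symmetric])
  then show ?thesis
    unfolding nonsquares_def by (auto dest: finite_imageD)
qed

text \<open>At most \<open>sqrt n + 1\<close> of the \<open>n + 1\<close> numbers up to \<open>n\<close> are squares.\<close>

lemma dense_set_nonsquares: "dense_set nonsquares"
proof -
  have lower: "real n - sqrt (real n) \<le> real (card (nonsquares \<inter> {0..n}))" for n
  proof -
    have "{0..n} - nonsquares \<subseteq> (\<lambda>m. m * m) ` {0..floor_sqrt n}"
      by (auto simp: nonsquares_def le_floor_sqrt_iff power2_eq_square)
    then have "card ({0..n} - nonsquares) \<le> Suc (floor_sqrt n)"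
      by (metis (no_types) card_atLeastAtMost diff_zero finite_atLeastAtMost surj_card_le)
    moreover have "card {0..n} = card (nonsquares \<inter> {0..n}) + card ({0..n} - nonsquares)"
      using card_Int_Diff[of "{0..n}" nonsquares] by (simp add: Int_commute)
    moreover have "real (floor_sqrt n) \<le> sqrt (real n)"
      using floor_sqrt_power2_le[of n] by (intro real_le_rsqrt) (simp flip: of_nat_power)
    ultimately show ?thesis
      by simp
  qed
  have upper: "card (nonsquares \<inter> {0..n}) \<le> Suc n" for n
    using card_mono[of "{0..n}" "nonsquares \<inter> {0..n}"] by simp
  show ?thesis
    unfolding dense_set_def
  proof (rule tendsto_sandwich)
    show "\<forall>\<^sub>F n in sequentially.
        (real n - sqrt (real n)) / (real n + 1) \<le> real (card (nonsquares \<inter> {0..n})) / (real n + 1)"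
      using lower by (intro always_eventually allI divide_right_mono) auto
    show "\<forall>\<^sub>F n in sequentially. real (card (nonsquares \<inter> {0..n})) / (real n + 1) \<le> 1"
      using upper
      by (intro always_eventually allI)
        (simp add: divide_le_eq, metis of_nat_Suc of_nat_le_iff add.commute)
    show "(\<lambda>n. (real n - sqrt (real n)) / (real n + 1)) \<longlonglongrightarrow> 1"
      by real_asymp
  qed auto
qed

section \<open>Order types of tuples\<close>

text \<open>
  The strict comparisons also record which entries are equal: those with neither smaller than the
  other.
\<close>

definition order_type :: "nat list \<Rightarrow> (nat \<times> nat) set" where
  "order_type xs = {(i, j). i < length xs \<and> j < length xs \<and> xs ! i < xs ! j}"

lemma order_type_subset: "order_type xs \<subseteq> {..<length xs} \<times> {..<length xs}"
  by (auto simp: order_type_def)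

lemma order_type_map:
  assumes "strict_mono_on A f" and "set xs \<subseteq> A"
  shows "order_type (map f xs) = order_type xs"
proof -
  have "f (xs ! i) < f (xs ! j) \<longleftrightarrow> xs ! i < xs ! j" if "i < length xs" "j < length xs" for i j
    using strict_mono_on_less[OF assms(1)] assms(2) that nth_mem by blast
  then show ?thesis
    by (auto simp: order_type_def)
qed

lemma nth_less_iff_of_order_type_eq:
  assumes "order_type xs = order_type ys" and "length xs = length ys"
    and "i < length xs" and "j < length xs"
  shows "xs ! i < xs ! j \<longleftrightarrow> ys ! i < ys ! j"
proof -
  have "(i, j) \<in> order_type xs \<longleftrightarrow> (i, j) \<in> order_type ys"
    using assms(1) by simp
  then show ?thesis
    using assms(2-4) by (simp add: order_type_def)
qed

lemma card_image_eq_if_same_kernel: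
  assumes "\<And>x y. x \<in> A \<Longrightarrow> y \<in> A \<Longrightarrow> f x = f y \<longleftrightarrow> g x = g y"
  shows "card (f ` A) = card (g ` A)"
proof -
  have g: "g (inv_into A f (f x)) = g x" if "x \<in> A" for x
    using assms[of "inv_into A f (f x)" x] that by (simp add: f_inv_into_f inv_into_into)
  then have "inj_on (\<lambda>u. g (inv_into A f u)) (f ` A)"
    using assms by (auto simp: inj_on_def)
  then have "card ((\<lambda>u. g (inv_into A f u)) ` f ` A) = card (f ` A)"
    by (rule card_image)
  moreover have "(\<lambda>u. g (inv_into A f u)) ` f ` A = g ` A"
    unfolding image_image using g by (rule image_cong[OF refl])
  ultimately show ?thesis
    by simp
qed

lemma card_set_eq_of_order_type_eq:
  assumes "order_type xs = order_type ys" and "length xs = length ys"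
  shows "card (set xs) = card (set ys)"
proof -
  have "card ((!) xs ` {..<length xs}) = card ((!) ys ` {..<length xs})"
  proof (rule card_image_eq_if_same_kernel)
    fix i j assume "i \<in> {..<length xs}" "j \<in> {..<length xs}"
    then show "xs ! i = xs ! j \<longleftrightarrow> ys ! i = ys ! j"
      using nth_less_iff_of_order_type_eq[OF assms, of i j]
        nth_less_iff_of_order_type_eq[OF assms, of j i] by auto
  qed
  moreover have "(!) xs ` {..<length xs} = set xs" "(!) ys ` {..<length xs} = set ys"
    using assms(2) by (auto simp: set_conv_nth)
  ultimately show ?thesis
    by simp
qed

text \<open>
  Suppose the two tuples differ, and consider the smallest value at which they do, occurring in \<open>xs\<close>,
  say, at position \<open>i\<close>. Then \<open>xs ! i < ys ! i\<close>; this value also occurs in \<open>ys\<close>, at some position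
  \<open>j\<close> with \<open>ys ! j < ys ! i\<close>. Having the same order type, \<open>xs\<close> takes a smaller value at \<open>j\<close>, where
  the tuples differ too.
\<close>

lemma order_type_and_set_inject:
  assumes ot: "order_type xs = order_type ys" and len: "length xs = length ys"
    and set: "set xs = set ys"
  shows "xs = ys"
proof -
  \<comment> \<open>Stated for both tuples as variables, because either of them can be the smaller one at \<open>i\<close>.\<close>
  have agree_at: "vs ! i = v"
    if IH: "\<And>w i. w < v \<Longrightarrow> i < length us \<Longrightarrow> us ! i = w \<longleftrightarrow> vs ! i = w"
      and us: "order_type us = order_type vs" "length us = length vs" "set us = set vs"
      and i: "i < length us" and v: "us ! i = v" for us vs i and v :: nat
  proof (rule ccontr)
    assume "vs ! i \<noteq> v"
    moreover have "\<not> vs ! i < v"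
    proof
      assume less: "vs ! i < v"
      from IH[OF this i] have "us ! i = vs ! i"
        by blast
      with less v show False
        by linarith
    qed
    ultimately have "v < vs ! i"
      by linarith
    moreover have "v \<in> set vs"
      using nth_mem[OF i] v us(3) by blast
    then obtain j where j: "j < length us" "vs ! j = v"
      unfolding in_set_conv_nth us(2) by blast
    ultimately have "us ! j < v"
      using nth_less_iff_of_order_type_eq[OF us(1,2) j(1) i] unfolding v j(2) by blast
    moreover from IH[OF this j(1)] have "vs ! j = us ! j"
      by blast
    ultimately show False
      using j(2) by linarith
  qed
  have "xs ! i = v \<longleftrightarrow> ys ! i = v" if "i < length xs" for v i
    using that
  proof (induction v arbitrary: i rule: less_induct)
    case (less v)
    have IH': "ys ! m = w \<longleftrightarrow> xs ! m = w" if "w < v" "m < length ys" for w m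
      using less.IH[OF that(1), of m] that(2) unfolding len by blast
    have "i < length ys"
      using less.prems len by simp
    show ?case
    proof
      show "ys ! i = v" if "xs ! i = v"
        using less.IH ot len set less.prems that by (rule agree_at[of v xs ys i])
      show "xs ! i = v" if "ys ! i = v"
        using IH' ot[symmetric] len[symmetric] set[symmetric] \<open>i < length ys\<close> that
        by (rule agree_at[of v ys xs i])
    qed
  qed
  then show ?thesis
    using len by (intro nth_equalityI) blast+
qed

text \<open>
  There are finitely many order types of \<open>k\<close>-tuples, each described by finitely many comparisons of entries,
  so every set of order types, however it is given, is decided by a finite table.
\<close>

lemma computable_relation_order_type:
  "computable_relation k {xs. length xs = k \<and> order_type xs \<in> P}"
proof -
  define C where "C = (\<lambda>(i, j). {xs :: nat list. xs ! i < xs ! j})"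
  define B where "B = (\<lambda>p. \<Inter>a\<in>{..<k} \<times> {..<k}. if a \<in> p then C a else - C a)"
  have B: "xs \<in> B p \<longleftrightarrow> order_type xs = p"
    if len: "length xs = k" and p: "p \<subseteq> {..<k} \<times> {..<k}" for xs p
  proof -
    have "xs \<in> B p \<longleftrightarrow> (\<forall>a\<in>{..<k} \<times> {..<k}. a \<in> order_type xs \<longleftrightarrow> a \<in> p)"
      unfolding B_def C_def INT_iff using len
      by (intro ball_cong refl) (auto simp: order_type_def)
    also have "\<dots> \<longleftrightarrow> order_type xs = p"
      using p order_type_subset[of xs] unfolding len by blast
    finally show ?thesis .
  qed
  have "computable_relation k (\<Union>p\<in>P \<inter> Pow ({..<k} \<times> {..<k}). B p)"
  proof (intro computable_relation_UN)
    have C: "computable_relation k (C a)" if "a \<in> {..<k} \<times> {..<k}" for a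
      using that unfolding C_def
      by (auto intro!: computable_relation_less computable_fun_nth)
    show "computable_relation k (B p)" for p
      unfolding B_def using C computable_relation_Compl[OF C]
      by (intro computable_relation_INT) auto
  qed auto
  moreover have "xs \<in> (\<Union>p\<in>P \<inter> Pow ({..<k} \<times> {..<k}). B p) \<longleftrightarrow>
      xs \<in> {xs. length xs = k \<and> order_type xs \<in> P}" if "length xs = k" for xs
    using B[OF that] order_type_subset[of xs] that by auto
  ultimately show ?thesis
    by (rule computable_relation_cong[THEN iffD1, rotated])
qed

section \<open>Order-homogeneous sets\<close>

definition order_homogeneous :: "nat \<Rightarrow> nat list set \<Rightarrow> nat set \<Rightarrow> bool" where
  "order_homogeneous k R Y \<longleftrightarrow>
     (\<forall>xs\<in>tuples k Y. \<forall>ys\<in>tuples k Y. order_type xs = order_type ys \<longrightarrow> (xs \<in> R \<longleftrightarrow> ys \<in> R))"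

text \<open>
  Ramsey's theorem for a single order type \<open>p\<close>. All tuples of order type \<open>p\<close> have the same number \<open>m\<close>
  of distinct entries, and each \<open>m\<close>-element set is the set of entries of at most one of them. So whether \<open>R\<close>
  holds of such a tuple is a two-colouring of the \<open>m\<close>-element sets.
\<close>

lemma ex_homogeneous_for_order_type:
  assumes "infinite Z"
  shows "\<exists>Y\<subseteq>Z. infinite Y \<and>
    (\<forall>xs\<in>tuples k Y. \<forall>ys\<in>tuples k Y.
      order_type xs = p \<longrightarrow> order_type ys = p \<longrightarrow> (xs \<in> R \<longleftrightarrow> ys \<in> R))"
proof (cases "\<exists>xs. length xs = k \<and> order_type xs = p")
  case False
  with assms show ?thesis
    by (intro exI[of _ Z]) (auto simp: tuples_def)
next
  case True
  then obtain xs0 where xs0: "length xs0 = k" "order_type xs0 = p"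
    by blast
  define holds where
    "holds X \<longleftrightarrow> (\<exists>xs. length xs = k \<and> order_type xs = p \<and> set xs = X \<and> xs \<in> R)" for X
  have holds_set: "holds (set xs) \<longleftrightarrow> xs \<in> R" if "length xs = k" "order_type xs = p" for xs
    unfolding holds_def using order_type_and_set_inject that by metis
  have "\<exists>Y t. Y \<subseteq> Z \<and> infinite Y \<and> t < (2 :: nat) \<and>
      (\<forall>X. X \<subseteq> Y \<and> finite X \<and> card X = card (set xs0) \<longrightarrow> of_bool (holds X) = t)"
    by (rule Ramsey[OF assms]) auto
  then obtain Y t where Y: "Y \<subseteq> Z" "infinite Y"
    and t: "\<forall>X. X \<subseteq> Y \<and> finite X \<and> card X = card (set xs0) \<longrightarrow> of_bool (holds X) = (t :: nat)"
    by (elim exE conjE)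
  have "xs \<in> R \<longleftrightarrow> ys \<in> R"
    if "xs \<in> tuples k Y" "ys \<in> tuples k Y" "order_type xs = p" "order_type ys = p" for xs ys
  proof -
    have "of_bool (holds (set zs)) = t"
      if zs: "zs \<in> tuples k Y" "order_type zs = p" for zs
    proof -
      have "card (set zs) = card (set xs0)"
        by (rule card_set_eq_of_order_type_eq) (use zs xs0 in \<open>simp_all add: tuples_def\<close>)
      moreover have "set zs \<subseteq> Y"
        using zs by (simp add: tuples_def)
      ultimately show ?thesis
        using t by blast
    qed
    from this[of xs] this[of ys] that have "(of_bool (holds (set xs)) :: nat) = of_bool (holds (set ys))"
      by simp
    then have "holds (set xs) \<longleftrightarrow> holds (set ys)"
      by (simp only: of_bool_eq_iff)
    moreover have "length xs = k" "length ys = k"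
      using that by (simp_all add: tuples_def)
    ultimately show ?thesis
      using holds_set[of xs] holds_set[of ys] that(3,4) by blast
  qed
  with Y show ?thesis
    by blast
qed

text \<open>Thinning out once for each \<open>i\<close> works, since later thinning preserves the earlier properties.\<close>

lemma ex_infinite_subset_with_all:
  assumes "finite I" and "infinite Z"
    and step: "\<And>i Z. i \<in> I \<Longrightarrow> infinite Z \<Longrightarrow> \<exists>Y\<subseteq>Z. infinite Y \<and> Q i Y"
    and hereditary: "\<And>i Y Z. Q i Z \<Longrightarrow> Y \<subseteq> Z \<Longrightarrow> Q i Y"
  shows "\<exists>Y\<subseteq>Z. infinite Y \<and> (\<forall>i\<in>I. Q i Y)"
  using assms(1) step
proof (induction I rule: finite_induct)
  case empty
  with assms(2) show ?case
    by blast
next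
  case (insert i I)
  then obtain Y where Y: "Y \<subseteq> Z" "infinite Y" "\<forall>i\<in>I. Q i Y"
    by auto
  with insert.prems[of i Y] obtain Y' where "Y' \<subseteq> Y" "infinite Y'" "Q i Y'"
    by auto
  with Y hereditary show ?case
    by (intro exI[of _ Y']) blast
qed

text \<open>
  The thinning is indexed by a relation symbol together with an order type of the right length, of which
  there are finitely many.
\<close>

lemma ex_order_homogeneous:
  fixes S :: "'r set" and a :: "'r \<Rightarrow> nat" and I :: "'r \<Rightarrow> nat list set"
  assumes "finite S"
  shows "\<exists>Y. infinite Y \<and> (\<forall>R\<in>S. order_homogeneous (a R) (I R) Y)"
proof -
  define Q where "Q = (\<lambda>(R, p) Y. \<forall>xs\<in>tuples (a R) Y. \<forall>ys\<in>tuples (a R) Y.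
      order_type xs = p \<longrightarrow> order_type ys = p \<longrightarrow> (xs \<in> I R \<longleftrightarrow> ys \<in> I R))"
  have "\<exists>Y\<subseteq>UNIV. infinite Y \<and> (\<forall>i\<in>(SIGMA R:S. Pow ({..<a R} \<times> {..<a R})). Q i Y)"
  proof (rule ex_infinite_subset_with_all)
    show "finite (SIGMA R:S. Pow ({..<a R} \<times> {..<a R}))"
      using assms by auto
    show "\<exists>Y\<subseteq>Z. infinite Y \<and> Q i Y" if "infinite Z" for i Z
      unfolding Q_def using ex_homogeneous_for_order_type[OF that] by (auto split: prod.split)
    show "Q i Y" if "Q i Z" "Y \<subseteq> Z" for i Y Z
    proof -
      have "tuples k Y \<subseteq> tuples k Z" for k
        using that by (auto simp: tuples_def)
      then show ?thesis
        using that(1) unfolding Q_def by (auto split: prod.splits) blast+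
    qed
  qed auto
  then obtain Y where Y: "infinite Y" "\<And>R p. R \<in> S \<Longrightarrow> p \<subseteq> {..<a R} \<times> {..<a R} \<Longrightarrow> Q (R, p) Y"
    by auto
  have "order_homogeneous (a R) (I R) Y" if "R \<in> S" for R
    unfolding order_homogeneous_def
  proof (intro ballI impI)
    fix xs ys assume xs: "xs \<in> tuples (a R) Y" "ys \<in> tuples (a R) Y" "order_type xs = order_type ys"
    then have "Q (R, order_type xs) Y"
      using Y(2)[OF that] order_type_subset[of xs] by (simp add: tuples_def)
    with xs show "xs \<in> I R \<longleftrightarrow> ys \<in> I R"
      unfolding Q_def prod.case by metis
  qed
  with Y(1) show ?thesis
    by blast
qed

text \<open>
  Mapping \<open>x\<close> to the element number \<open>2 * x\<close> of \<open>Y\<close> is increasing, and leaves infinitely many elements of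
  \<open>Y\<close> unused, so the two complements can be matched up.
\<close>

lemma ex_bij_increasing_on:
  fixes D Y :: "nat set"
  assumes "infinite Y" and "infinite (- D)"
  shows "\<exists>g. bij g \<and> strict_mono_on D g \<and> g ` D \<subseteq> Y"
proof -
  define e where "e x = enumerate Y (2 * x)" for x
  have mono: "strict_mono e"
    using assms(1) by (auto simp: e_def strict_mono_def enumerate_mono)
  have "range (\<lambda>x. enumerate Y (2 * x + 1)) \<subseteq> - e ` D"
  proof -
    have "enumerate Y (2 * x + 1) \<noteq> enumerate Y (2 * y)" for x y
      using inj_eq[OF inj_enumerate[OF assms(1)], of "2 * x + 1" "2 * y"] by presburger
    then show ?thesis
      by (auto simp: e_def)
  qed
  moreover have "inj (\<lambda>x. enumerate Y (2 * x + 1))"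
    using inj_eq[OF inj_enumerate[OF assms(1)]] by (simp add: inj_on_def)
  ultimately have "infinite (- e ` D)"
    using range_inj_infinite infinite_super by blast
  from bij_betw_trans[OF bij_betw_inv_into[OF bij_enumerate[OF assms(2)]] bij_enumerate[OF this]]
  obtain c where c: "bij_betw c (- D) (- e ` D)" ..
  define g where "g x = (if x \<in> D then e x else c x)" for x
  have "bij_betw g (D \<union> - D) (e ` D \<union> - e ` D)"
  proof (rule bij_betw_combine)
    have "bij_betw e D (e ` D)"
      using strict_mono_imp_inj_on[OF mono] by (rule inj_on_imp_bij_betw)
    then show "bij_betw g D (e ` D)"
      by (rule bij_betw_cong[THEN iffD1, rotated]) (simp add: g_def)
    show "bij_betw g (- D) (- e ` D)"
      using c by (rule bij_betw_cong[THEN iffD1, rotated]) (simp add: g_def)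
  qed auto
  then have "bij g"
    by simp
  moreover have "strict_mono_on D g"
    using mono by (auto simp: strict_mono_on_def strict_mono_def g_def)
  moreover have "g ` D \<subseteq> Y"
    using enumerate_in_set[OF assms(1)] by (auto simp: g_def e_def)
  ultimately show ?thesis
    by blast
qed

section \<open>Structures determined by order types\<close>

definition order_structure :: "'r language \<Rightarrow> ('r \<Rightarrow> (nat \<times> nat) set set) \<Rightarrow> 'r rstruct" where
  "order_structure L P =
     \<lparr>univ = UNIV, interp = (\<lambda>R. {xs. length xs = arity L R \<and> order_type xs \<in> P R})\<rparr>"

lemma computable_structure_order_structure: "computable_structure L (order_structure L P)"
  using computable_relation_order_type
  by (auto simp: computable_structure_def order_structure_def is_structure_def tuples_def)

definition restrict_structure :: "'r language \<Rightarrow> 'r rstruct \<Rightarrow> nat set \<Rightarrow> 'r rstruct" where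
  "restrict_structure L M A = \<lparr>univ = A, interp = (\<lambda>R. interp M R \<inter> tuples (arity L R) A)\<rparr>"

lemma substructure_restrict_structure:
  assumes "is_structure L M" and "A \<subseteq> univ M" and "A \<noteq> {}"
  shows "substructure L (restrict_structure L M A) M"
  using assms by (auto simp: substructure_def restrict_structure_def is_structure_def)

definition pullback_structure :: "'r language \<Rightarrow> (nat \<Rightarrow> nat) \<Rightarrow> 'r rstruct \<Rightarrow> 'r rstruct" where
  "pullback_structure L g M =
     \<lparr>univ = UNIV, interp = (\<lambda>R. {xs. length xs = arity L R \<and> map g xs \<in> interp M R})\<rparr>"

lemma is_copy_pullback_structure:
  assumes "bij g" and "univ M = UNIV"
  shows "is_copy L M (pullback_structure L g M)"
proof -
  have "map g (map (inv g) xs) = xs" for xs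
    using assms(1) by (intro map_idI[THEN trans[OF map_map]]) (simp add: bij_is_surj surj_f_inv_f)
  then show ?thesis
    using assms bij_imp_bij_inv[OF assms(1)]
    by (auto simp: is_copy_def is_structure_def pullback_structure_def isomorphic_def tuples_def
        intro!: exI[of _ "inv g"])
qed

theorem theorem5p10:
  fixes L :: "'r language" and T :: "'r fm set"
  assumes "finite (symbols L)"
    and "is_theory L T"
  shows "zero_Ramsey_property L (infinite_models L T) \<and>
    (\<forall>M\<in>infinite_models L T. \<exists>N. is_copy L M N \<and> generically_computable L N) \<and>
    (\<forall>M\<in>infinite_models L T. \<exists>N. is_copy L M N \<and> coarsely_computable L N)"
proof -
  have "(\<exists>N. substructure L N M \<and> infinite (univ N) \<and> (\<exists>C. is_copy L N C \<and> computable_structure L C)) \<and>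
      (\<exists>N. is_copy L M N \<and> generically_computable L N \<and> coarsely_computable L N)"
    if "M \<in> infinite_models L T" for M
  proof -
    have M: "is_structure L M" "univ M = UNIV"
      using that by (auto simp: infinite_models_def is_model_def)
    obtain Y where Y: "infinite Y"
      and hom: "\<And>R. R \<in> symbols L \<Longrightarrow> order_homogeneous (arity L R) (interp M R) Y"
      using ex_order_homogeneous[OF assms(1)] by meson
    define P where "P R = order_type ` (interp M R \<inter> tuples (arity L R) Y)" for R
    have P: "xs \<in> interp M R \<longleftrightarrow> order_type xs \<in> P R"
      if "R \<in> symbols L" "xs \<in> tuples (arity L R) Y" for R xs
      using hom[OF that(1)] that(2) unfolding P_def order_homogeneous_def by blast
    define E where "E = order_structure L P"
    have E: "computable_structure L E"
      unfolding E_def by (rule computable_structure_order_structure)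
    have in_E: "xs \<in> interp E R \<longleftrightarrow> length xs = arity L R \<and> order_type xs \<in> P R" for xs R
      by (simp add: E_def order_structure_def)

    define H where "H = restrict_structure L M Y"
    have H: "substructure L H M"
      unfolding H_def using M Y by (intro substructure_restrict_structure) auto
    have univ_H: "univ H = Y"
      by (simp add: H_def restrict_structure_def)
    have "is_copy L H E"
    proof -
      define f where "f = inv_into UNIV (enumerate Y)"
      have bij: "bij_betw (enumerate Y) UNIV Y"
        using Y by (rule bij_enumerate)
      then have "bij_betw f Y UNIV"
        unfolding f_def by (rule bij_betw_inv_into)
      moreover have "strict_mono_on Y f"
      proof (rule strict_mono_onI)
        fix x y assume xy: "x \<in> Y" "y \<in> Y" "x < y"
        then have "enumerate Y (f x) < enumerate Y (f y)"
          unfolding f_def using bij_betw_inv_into_right[OF bij] by simp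
        then show "f x < f y"
          using Y by (simp add: enumerate_mono_iff)
      qed
      then have "xs \<in> interp H R \<longleftrightarrow> map f xs \<in> interp E R"
        if "R \<in> symbols L" "xs \<in> tuples (arity L R) Y" for R xs
        using that P[OF that] order_type_map[of Y f xs]
        by (auto simp: H_def restrict_structure_def in_E tuples_def)
      moreover have "is_structure L E" "univ E = UNIV"
        using E by (auto simp: computable_structure_def)
      ultimately show ?thesis
        unfolding is_copy_def isomorphic_def univ_H by auto
    qed
    moreover obtain g where g: "bij g" "strict_mono_on nonsquares g" "g ` nonsquares \<subseteq> Y"
      using ex_bij_increasing_on[OF Y infinite_Compl_nonsquares] by blast
    define N where "N = pullback_structure L g M"
    have N: "is_copy L M N"
      unfolding N_def using g(1) M(2) by (rule is_copy_pullback_structure)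
    have agree: "xs \<in> interp N R \<longleftrightarrow> xs \<in> interp E R"
      if R: "R \<in> symbols L" and xs: "xs \<in> tuples (arity L R) nonsquares" for R xs
    proof -
      have "xs \<in> interp N R \<longleftrightarrow> map g xs \<in> interp M R"
        using xs by (simp add: N_def pullback_structure_def tuples_def)
      also have "\<dots> \<longleftrightarrow> order_type (map g xs) \<in> P R"
        using xs g(3) by (intro P[OF R]) (auto simp: tuples_def)
      also have "order_type (map g xs) = order_type xs"
        using xs by (intro order_type_map[OF g(2)]) (simp add: tuples_def)
      also have "order_type xs \<in> P R \<longleftrightarrow> xs \<in> interp E R"
        using xs by (simp add: in_E tuples_def)
      finally show ?thesis .
    qed
    have "generically_computable L N"
      unfolding generically_computable_def
    proof (intro exI[of _ nonsquares] conjI ballI dense_set_nonsquares ce_set_nonsquares)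
      fix R assume "R \<in> symbols L"
      with E agree show "\<exists>\<phi>. partial_computable (arity L R) \<phi> \<and>
          (\<forall>xs\<in>tuples (arity L R) nonsquares. \<phi> xs = Some (char_fun (interp N R) xs))"
        by (intro exI[of _ "\<lambda>xs. Some (char_fun (interp E R) xs)"])
          (auto simp: computable_structure_def computable_relation_def char_fun_def)
    qed
    moreover have "coarsely_computable L N"
    proof -
      define D where "D = restrict_structure L N nonsquares"
      have "2 \<in> nonsquares"
        unfolding nonsquares_eq by (auto intro: exI[of _ 1])
      then have D: "substructure L D N"
        unfolding D_def using N by (intro substructure_restrict_structure) (auto simp: is_copy_def)
      moreover have "substructure L D E"
        using D E agree
        by (auto simp: substructure_def D_def restrict_structure_def computable_structure_def)
      moreover have "dense_set (univ D)"
        using dense_set_nonsquares by (simp add: D_def restrict_structure_def)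
      ultimately show ?thesis
        using E unfolding coarsely_computable_def by blast
    qed
    ultimately show ?thesis
      using E H N Y univ_H by metis
  qed
  then show ?thesis
    unfolding zero_Ramsey_property_def by blast
qed

end
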